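(* Let $y_1,\dots,y_l$ and $z_1,\dots,z_m$ be sequences of distinct points in $D$. Then $$(\hat e(y_1)\cdots\hat e(y_l)\mathbf 1,\ \hat e(z_1)\cdots\hat e(z_m)\mathbf 1)=\begin{cases}0&\text{if }l\ne m,\\[4pt] \displaystyle\sum_\sigma\frac1{(1-u(z_1)\overline{u}(y_{\sigma(1)}))^2}\cdots\frac1{(1-u(z_l)\overline u(y_{\sigma(l)}))^2}&\text{if }l=m,\end{cases}$$ where the sum runs over all permutations $\sigma$ of $(1,\dots,l)$.
   Context: $\mathbb P$ is a complex projective line with canonical bundle $K$, $C:\mathbb P\to\mathbb P$ is the antiholomorphic involution which in a coordinate $u$ is $u(C(z))=1/\overline{u(z)}$. $D=\{|u|<1\}$, $D'=C(D)$ is the complement of its closure. ${}_D\mathbf K$ is the space of meromorphic 1-forms on $\mathbb P$ with all residues zero and all poles in $D$; ${}_D\mathbf W=S^*({}_D\mathbf K)$, with vacuum $\mathbf 1=1\in\mathbb C$. For $z\in D$, $\hat e(z):{}_D\mathbf W\to{}_D\mathbf W$ is multiplication by $-\frac{du}{(u-u(z))^2}$. For $z\notin D$, $z\neq$ the pole of $u$, $\hat i(z):{}_D\mathbf W\to{}_D\mathbf W$ is the derivation with $\hat i(z)\mathbf 1=0$ and $\hat i(z)(a\,du)=-a(z)$ for $a\,du\in{}_D\mathbf K$. $(\cdot,\cdot)$ is the hermitian form on ${}_D\mathbf W$ (antilinear in the first argument, linear in the second), compatible with derivatives of the fields in $z$, characterised by $(\mathbf 1,\mathbf 1)=1$, $u(z)^2(\chi,\hat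 e(z)\psi)=(\hat i(C(z))\chi,\psi)$ for $z\in D$ (at $u(z)=0$ by continuity: $(\chi,\hat e(z)\psi)$ is holomorphic in $z\in D$), and $u(z')^2(\chi,\hat i(z')\psi)=(\hat e(C(z'))\chi,\psi)$ for $z'\in D'$, for all $\chi,\psi\in{}_D\mathbf W$. $\overline u(y)$ denotes $\overline{u(y)}$. *)

theory Defs
  imports "HOL-Complex_Analysis.Complex_Analysis" "HOL-Library.Poly_Mapping"
    "HOL-Library.Multiset" "HOL-Combinatorics.Permutations"
begin

section \<open>The projective line\<close>

text \<open>
  The coordinate \<open>u\<close> identifies the projective line with the Riemann sphere; the pole of \<open>u\<close>
  is \<open>Infty\<close>, where the selector \<open>u\<close> is left unspecified.
\<close>

datatype proj_line = Fin (u: complex) | Infty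

fun Cinv :: "proj_line \<Rightarrow> proj_line" where
  "Cinv (Fin z) = (if z = 0 then Infty else Fin (1 / cnj z))"
| "Cinv Infty = Fin 0"

definition D :: "proj_line set" where
  "D = Fin ` {z. norm z < 1}"

definition D' :: "proj_line set" where
  "D' = Cinv ` D"

lemma Fin_in_D_iff [simp]: "Fin z \<in> D \<longleftrightarrow> norm z < 1"
  by (auto simp: D_def)

lemma Infty_notin_D [simp]: "Infty \<notin> D"
  by (auto simp: D_def)

lemma Fin_in_D'_iff [simp]: "Fin z \<in> D' \<longleftrightarrow> norm z > 1"
proof
  assume "Fin z \<in> D'"
  then obtain y where "norm y < 1" "y \<noteq> 0" "z = 1 / cnj y"
    by (auto simp: D'_def D_def split: if_splits)
  then show "norm z > 1"
    by (simp add: norm_divide)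
next
  assume z: "norm z > 1"
  then have "z \<noteq> 0" by auto
  with z have "Fin z = Cinv (Fin (1 / cnj z))" "Fin (1 / cnj z) \<in> D"
    by (auto simp: norm_divide)
  then show "Fin z \<in> D'"
    unfolding D'_def by (rule image_eqI)
qed


section \<open>Meromorphic 1-forms without residues and with poles in \<open>D\<close>\<close>

text \<open>
  A meromorphic 1-form is written \<open>a du\<close>. Its coefficient with respect to a local coordinate
  \<open>w\<close> vanishing at \<open>p\<close> is \<open>a (z + w)\<close> for \<open>p = Fin z\<close>, \<open>w = u - z\<close>. At \<open>Infty\<close> the coordinate
  is \<open>w = 1 / u\<close> and \<open>du = - dw / w\<^sup>2\<close>.
\<close>

fun loc_coeff :: "(complex \<Rightarrow> complex) \<Rightarrow> proj_line \<Rightarrow> complex \<Rightarrow> complex" where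
  "loc_coeff a (Fin z) w = a (z + w)"
| "loc_coeff a Infty w = - a (1 / w) / w ^ 2"

definition in_DK :: "(complex \<Rightarrow> complex) \<Rightarrow> bool" where
  "in_DK a \<longleftrightarrow> (\<forall>p. loc_coeff a p meromorphic_on {0} \<and> residue (loc_coeff a p) 0 = 0 \<and>
                   (is_pole (loc_coeff a p) 0 \<longrightarrow> p \<in> D))"

text \<open>
  Coefficient functions that agree off a discrete set give the same form; the value that a
  total function takes at a pole is immaterial.
\<close>

definition same_form :: "(complex \<Rightarrow> complex) \<Rightarrow> (complex \<Rightarrow> complex) \<Rightarrow> bool" where
  "same_form a b \<longleftrightarrow> in_DK a \<and> in_DK b \<and> (\<forall>z. \<forall>\<^sub>F w in at z. a w = b w)"

lemma loc_coeff_add: "loc_coeff (\<lambda>w. a w + b w) p = (\<lambda>w. loc_coeff a p w + loc_coeff b p w)"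
  by (cases p) (auto simp: fun_eq_iff add_divide_distrib diff_divide_distrib)

lemma loc_coeff_scale: "loc_coeff (\<lambda>w. c * a w) p = (\<lambda>w. c * loc_coeff a p w)"
  by (cases p) (auto simp: fun_eq_iff)

lemma loc_coeff_zero: "loc_coeff (\<lambda>w. 0) p = (\<lambda>w. 0)"
  by (cases p) (auto simp: fun_eq_iff)

lemma not_pole_has_limit:
  assumes "f meromorphic_on {z}" "\<not> is_pole f z"
  shows "\<exists>c. f \<midarrow>z\<rightarrow> c"
  using assms by (auto simp: meromorphic_at_iff not_essential_def)

lemma has_limit_not_pole: "(f :: complex \<Rightarrow> complex) \<midarrow>z\<rightarrow> c \<Longrightarrow> \<not> is_pole f z"
  by (auto simp: is_pole_def dest: not_tendsto_and_filterlim_at_infinity[rotated])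

lemma residue_add_meromorphic:
  assumes "f meromorphic_on {0}" "g meromorphic_on {0}"
  shows "residue (\<lambda>w. f w + g w) 0 = residue f 0 + residue g 0"
proof -
  obtain F G where *: "f has_laurent_expansion F" "g has_laurent_expansion G"
    using assms unfolding meromorphic_on_def by auto
  have "(\<lambda>w. f w + g w) has_laurent_expansion F + G"
    by (intro laurent_expansion_intros *)
  with * show ?thesis by (simp add: has_laurent_expansion_residue_0)
qed

lemma residue_scale_meromorphic:
  assumes "f meromorphic_on {0}"
  shows "residue (\<lambda>w. c * f w) 0 = c * residue f 0"
proof -
  obtain F where *: "f has_laurent_expansion F"
    using assms unfolding meromorphic_on_def by auto
  have "(\<lambda>w. c * f w) has_laurent_expansion fls_const c * F"
    by (intro laurent_expansion_intros *)
  with * show ?thesis by (simp add: has_laurent_expansion_residue_0)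
qed

lemma in_DK_zero: "in_DK (\<lambda>w. 0)"
  by (auto simp: in_DK_def loc_coeff_zero residue_const has_limit_not_pole[OF tendsto_const])

lemma in_DK_add:
  assumes "in_DK a" "in_DK b"
  shows "in_DK (\<lambda>w. a w + b w)"
  unfolding in_DK_def
proof
  fix p
  have m: "loc_coeff a p meromorphic_on {0}" "loc_coeff b p meromorphic_on {0}"
    and r: "residue (loc_coeff a p) 0 = 0" "residue (loc_coeff b p) 0 = 0"
    using assms by (auto simp: in_DK_def)
  have "p \<in> D" if "is_pole (\<lambda>w. loc_coeff a p w + loc_coeff b p w) 0"
  proof (rule ccontr)
    assume "p \<notin> D"
    then have "\<not> is_pole (loc_coeff a p) 0" "\<not> is_pole (loc_coeff b p) 0"
      using assms by (auto simp: in_DK_def)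
    then obtain c d where "loc_coeff a p \<midarrow>0\<rightarrow> c" "loc_coeff b p \<midarrow>0\<rightarrow> d"
      using not_pole_has_limit m by metis
    from has_limit_not_pole[OF tendsto_add[OF this]] that show False by simp
  qed
  then show "loc_coeff (\<lambda>w. a w + b w) p meromorphic_on {0} \<and>
      residue (loc_coeff (\<lambda>w. a w + b w) p) 0 = 0 \<and>
      (is_pole (loc_coeff (\<lambda>w. a w + b w) p) 0 \<longrightarrow> p \<in> D)"
    unfolding loc_coeff_add using m r
    by (auto simp: residue_add_meromorphic intro!: meromorphic_intros)
qed

lemma in_DK_scale:
  assumes "in_DK a"
  shows "in_DK (\<lambda>w. c * a w)"
  unfolding in_DK_def
proof
  fix p
  have m: "loc_coeff a p meromorphic_on {0}" and r: "residue (loc_coeff a p) 0 = 0"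
    using assms by (auto simp: in_DK_def)
  have "p \<in> D" if "is_pole (\<lambda>w. c * loc_coeff a p w) 0"
  proof (rule ccontr)
    assume "p \<notin> D"
    then have "\<not> is_pole (loc_coeff a p) 0"
      using assms by (auto simp: in_DK_def)
    then obtain d where "loc_coeff a p \<midarrow>0\<rightarrow> d"
      using not_pole_has_limit m by metis
    from has_limit_not_pole[OF tendsto_mult[OF tendsto_const this]] that show False by simp
  qed
  then show "loc_coeff (\<lambda>w. c * a w) p meromorphic_on {0} \<and>
      residue (loc_coeff (\<lambda>w. c * a w) p) 0 = 0 \<and>
      (is_pole (loc_coeff (\<lambda>w. c * a w) p) 0 \<longrightarrow> p \<in> D)"
    unfolding loc_coeff_scale using m r
    by (auto simp: residue_scale_meromorphic intro!: meromorphic_intros)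
qed

quotient_type DK = "complex \<Rightarrow> complex" / partial: same_form
proof (rule part_equivpI)
  show "\<exists>x. same_form x x"
    using in_DK_zero by (auto simp: same_form_def)
  show "symp same_form"
    by (auto simp: same_form_def symp_def eq_commute)
  show "transp same_form"
  proof (rule transpI)
    fix x y z assume "same_form x y" "same_form y z"
    moreover have "\<forall>\<^sub>F w in at t. x w = z w"
      if "\<forall>\<^sub>F w in at t. x w = y w" "\<forall>\<^sub>F w in at t. y w = z w" for t
      using that by eventually_elim simp
    ultimately show "same_form x z"
      by (auto simp: same_form_def)
  qed
qed

class complex_vector = ab_group_add +
  fixes scaleC :: "complex \<Rightarrow> 'a \<Rightarrow> 'a"
  assumes scaleC_add_right: "scaleC c (x + y) = scaleC c x + scaleC c y"
    and scaleC_add_left: "scaleC (c + d) x = scaleC c x + scaleC d x"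
    and scaleC_scaleC: "scaleC c (scaleC d x) = scaleC (c * d) x"
    and scaleC_one: "scaleC 1 x = x"

instantiation DK :: complex_vector
begin

lift_definition zero_DK :: DK is "\<lambda>w. 0"
  using in_DK_zero by (auto simp: same_form_def)

lift_definition plus_DK :: "DK \<Rightarrow> DK \<Rightarrow> DK" is "\<lambda>a b w. a w + b w"
  unfolding same_form_def by (fastforce intro: in_DK_add elim: eventually_elim2)

lift_definition scaleC_DK :: "complex \<Rightarrow> DK \<Rightarrow> DK" is "\<lambda>c a w. c * a w"
  unfolding same_form_def by (fastforce intro: in_DK_scale elim: eventually_mono)

lift_definition uminus_DK :: "DK \<Rightarrow> DK" is "\<lambda>a w. - a w"
proof -
  fix a b assume "same_form a b"
  then show "same_form (\<lambda>w. - a w) (\<lambda>w. - b w)"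
    using in_DK_scale[of a "-1"] in_DK_scale[of b "-1"] by (auto simp: same_form_def)
qed

definition minus_DK :: "DK \<Rightarrow> DK \<Rightarrow> DK" where
  "minus_DK a b = a + - b"

instance
proof
  fix a b c :: DK and r s :: complex
  show "a + b + c = a + (b + c)"
    by transfer (auto simp: same_form_def add.assoc intro!: in_DK_add)
  show "a + b = b + a"
    by transfer (auto simp: same_form_def add.commute intro!: in_DK_add)
  show "0 + a = a"
    by transfer (auto simp: same_form_def)
  show "- a + a = 0"
    by transfer (auto simp: same_form_def in_DK_zero)
  show "a - b = a + - b"
    by (simp add: minus_DK_def)
  show "scaleC r (a + b) = scaleC r a + scaleC r b"
    by transfer (auto simp: same_form_def ring_distribs intro!: in_DK_add in_DK_scale)
  show "scaleC (r + s) a = scaleC r a + scaleC s a"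
    by transfer (auto simp: same_form_def ring_distribs intro!: in_DK_add in_DK_scale)
  show "scaleC r (scaleC s a) = scaleC (r * s) a"
    by transfer (auto simp: same_form_def mult.assoc intro!: in_DK_scale)
  show "scaleC 1 a = a"
    by transfer (auto simp: same_form_def)
qed

end

text \<open>The canonical representative \<open>a\<close> of a form \<open>a du\<close>, with removable singularities removed.\<close>

lift_definition coeff_fn :: "DK \<Rightarrow> complex \<Rightarrow> complex" is "\<lambda>a. remove_sings a"
proof -
  fix a b assume "same_form a b"
  then show "remove_sings a = remove_sings b"
    by (auto simp: same_form_def fun_eq_iff intro!: remove_sings_cong)
qed

lemma in_DK_limit:
  assumes "in_DK a" "Fin z \<notin> D"
  shows "\<exists>c. a \<midarrow>z\<rightarrow> c" "isolated_singularity_at a z"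
proof -
  have eq: "loc_coeff a (Fin z) = (\<lambda>w. a (z + w))"
    by auto
  have m: "(\<lambda>w. a (z + w)) meromorphic_on {0}" and "\<not> is_pole (\<lambda>w. a (z + w)) 0"
    using assms unfolding in_DK_def eq[symmetric] by blast+
  then obtain c where "(\<lambda>w. a (z + w)) \<midarrow>0\<rightarrow> c"
    using not_pole_has_limit by blast
  then show "\<exists>c. a \<midarrow>z\<rightarrow> c"
    by (auto simp: LIM_offset_zero_iff[where a = z])
  have "isolated_singularity_at (\<lambda>w. a (z + w)) 0"
    using m by (auto simp: meromorphic_at_iff)
  then show "isolated_singularity_at a z"
    by (simp add: isolated_singularity_at_shift_0)
qed

lemma remove_sings_analytic_DK:
  assumes "in_DK a" "Fin z \<notin> D"
  shows "remove_sings a analytic_on {z}"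
  using in_DK_limit[OF assms] by (auto simp: remove_sings_analytic_at)

lemma eventually_remove_sings_nhds_add:
  assumes "in_DK a" "in_DK b" "Fin z \<notin> D"
  shows "\<forall>\<^sub>F w in nhds z. remove_sings (\<lambda>w. a w + b w) w = remove_sings a w + remove_sings b w"
proof -
  obtain c d where cd: "a \<midarrow>z\<rightarrow> c" "b \<midarrow>z\<rightarrow> d"
    using in_DK_limit assms by metis
  have "\<forall>\<^sub>F w in at z. remove_sings (\<lambda>w. a w + b w) w = a w + b w"
    using in_DK_limit[OF in_DK_add[OF assms(1,2)] assms(3)]
    by (intro eventually_remove_sings_eq_at) auto
  moreover have "\<forall>\<^sub>F w in at z. remove_sings a w = a w" "\<forall>\<^sub>F w in at z. remove_sings b w = b w"
    using in_DK_limit assms by (auto intro!: eventually_remove_sings_eq_at)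
  ultimately have "\<forall>\<^sub>F w in at z.
      remove_sings (\<lambda>w. a w + b w) w = remove_sings a w + remove_sings b w"
    by eventually_elim simp
  moreover have "remove_sings (\<lambda>w. a w + b w) z = remove_sings a z + remove_sings b z"
    using remove_sings_eqI[OF tendsto_add[OF cd]] cd[THEN remove_sings_eqI] by simp
  ultimately show ?thesis
    by (auto simp: eventually_nhds_conv_at)
qed

lemma eventually_remove_sings_nhds_scale:
  assumes "in_DK a" "Fin z \<notin> D"
  shows "\<forall>\<^sub>F w in nhds z. remove_sings (\<lambda>w. c * a w) w = c * remove_sings a w"
proof -
  obtain d where d: "a \<midarrow>z\<rightarrow> d"
    using in_DK_limit assms by metis
  have "\<forall>\<^sub>F w in at z. remove_sings (\<lambda>w. c * a w) w = c * a w"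
    using in_DK_limit[OF in_DK_scale[OF assms(1)] assms(2)]
    by (intro eventually_remove_sings_eq_at) auto
  moreover have "\<forall>\<^sub>F w in at z. remove_sings a w = a w"
    using in_DK_limit assms by (auto intro!: eventually_remove_sings_eq_at)
  ultimately have "\<forall>\<^sub>F w in at z. remove_sings (\<lambda>w. c * a w) w = c * remove_sings a w"
    by eventually_elim simp
  moreover have "remove_sings (\<lambda>w. c * a w) z = c * remove_sings a z"
    using remove_sings_eqI[OF tendsto_mult[OF tendsto_const d]] remove_sings_eqI[OF d] by simp
  ultimately show ?thesis
    by (auto simp: eventually_nhds_conv_at)
qed

lemma higher_deriv_coeff_fn_add:
  assumes "Fin z \<notin> D"
  shows "(deriv ^^ n) (coeff_fn (a + b)) z = (deriv ^^ n) (coeff_fn a) z + (deriv ^^ n) (coeff_fn b) z"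
  using assms
proof (transfer fixing: z n)
  fix a b assume *: "same_form a a" "same_form b b" "Fin z \<notin> D"
  have "(deriv ^^ n) (remove_sings (\<lambda>w. a w + b w)) z =
        (deriv ^^ n) (\<lambda>w. remove_sings a w + remove_sings b w) z"
    by (rule higher_deriv_cong_ev[OF eventually_remove_sings_nhds_add])
       (use * in \<open>auto simp: same_form_def\<close>)
  also have "\<dots> = (deriv ^^ n) (remove_sings a) z + (deriv ^^ n) (remove_sings b) z"
    by (rule higher_deriv_add_at[OF remove_sings_analytic_DK remove_sings_analytic_DK])
       (use * in \<open>auto simp: same_form_def\<close>)
  finally show "(deriv ^^ n) (remove_sings (\<lambda>w. a w + b w)) z =
     (deriv ^^ n) (remove_sings a) z + (deriv ^^ n) (remove_sings b) z" .
qed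

lemma higher_deriv_coeff_fn_scale:
  assumes "Fin z \<notin> D"
  shows "(deriv ^^ n) (coeff_fn (scaleC c a)) z = c * (deriv ^^ n) (coeff_fn a) z"
  using assms
proof (transfer fixing: z n c)
  fix a assume *: "same_form a a" "Fin z \<notin> D"
  have "(deriv ^^ n) (remove_sings (\<lambda>w. c * a w)) z = (deriv ^^ n) (\<lambda>w. c * remove_sings a w) z"
    by (rule higher_deriv_cong_ev[OF eventually_remove_sings_nhds_scale])
       (use * in \<open>auto simp: same_form_def\<close>)
  also have "\<dots> = c * (deriv ^^ n) (remove_sings a) z"
  proof -
    have "(deriv ^^ n) (\<lambda>w. (\<lambda>w. c) w * remove_sings a w) z =
       (\<Sum>i = 0..n. of_nat (n choose i) * (deriv ^^ i) (\<lambda>w. c) z * (deriv ^^ (n - i)) (remove_sings a) z)"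
      by (rule higher_deriv_mult_at[OF _ remove_sings_analytic_DK])
         (use * in \<open>auto simp: same_form_def\<close>)
    also have "\<dots> = (\<Sum>i \<in> {0}. of_nat (n choose i) * (deriv ^^ i) (\<lambda>w. c) z * (deriv ^^ (n - i)) (remove_sings a) z)"
      by (rule sum.mono_neutral_right) (auto simp: higher_deriv_const)
    finally show ?thesis by simp
  qed
  finally show "(deriv ^^ n) (remove_sings (\<lambda>w. c * a w)) z = c * (deriv ^^ n) (remove_sings a) z" .
qed


section \<open>The symmetric algebra of a complex vector space\<close>

text \<open>
  The free commutative algebra on the underlying set of the vector space \<open>V\<close> (finitely
  supported functions on the monomials, which are the finite multisets in \<open>V\<close>) modulo the
  ideal that makes the inclusion of \<open>V\<close> linear.
\<close>

abbreviation free_var :: "'v \<Rightarrow> 'v multiset \<Rightarrow>\<^sub>0 complex" where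
  "free_var v \<equiv> Poly_Mapping.single {#v#} 1"

abbreviation free_const :: "complex \<Rightarrow> 'v multiset \<Rightarrow>\<^sub>0 complex" where
  "free_const c \<equiv> Poly_Mapping.single {#} c"

inductive_set sym_ideal :: "('v::complex_vector multiset \<Rightarrow>\<^sub>0 complex) set" where
  zero: "0 \<in> sym_ideal"
| add: "p \<in> sym_ideal \<Longrightarrow> q \<in> sym_ideal \<Longrightarrow> p + q \<in> sym_ideal"
| gen_add: "r * (free_var (v + w) - free_var v - free_var w) \<in> sym_ideal"
| gen_scale: "r * (free_var (scaleC c v) - free_const c * free_var v) \<in> sym_ideal"

lemma sym_ideal_mult: "p \<in> sym_ideal \<Longrightarrow> r * p \<in> sym_ideal"
proof (induction rule: sym_ideal.induct)
  case (gen_add s v w)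
  show ?case unfolding mult.assoc[symmetric] by (rule sym_ideal.gen_add)
next
  case (gen_scale s c v)
  show ?case unfolding mult.assoc[symmetric] by (rule sym_ideal.gen_scale)
qed (auto simp: distrib_left intro: sym_ideal.intros)

lemma sym_ideal_uminus: "p \<in> sym_ideal \<Longrightarrow> - p \<in> sym_ideal"
  using sym_ideal_mult[of p "-1"] by simp

definition sym_rel ::
    "('v::complex_vector multiset \<Rightarrow>\<^sub>0 complex) \<Rightarrow> ('v multiset \<Rightarrow>\<^sub>0 complex) \<Rightarrow> bool" where
  "sym_rel p q \<longleftrightarrow> p - q \<in> sym_ideal"

quotient_type (overloaded) 'v sym_alg = "'v::complex_vector multiset \<Rightarrow>\<^sub>0 complex" / sym_rel
proof (rule equivpI)
  show "reflp sym_rel"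
    by (auto simp: reflp_def sym_rel_def sym_ideal.zero)
  show "symp sym_rel"
    unfolding symp_def sym_rel_def using sym_ideal_uminus by fastforce
  show "transp sym_rel"
    unfolding transp_def sym_rel_def using sym_ideal.add by fastforce
qed

lemma free_alg_induct [case_names single sum]:
  fixes p :: "'v multiset \<Rightarrow>\<^sub>0 complex"
  assumes single: "\<And>k c. P (Poly_Mapping.single k c)"
    and sum: "\<And>p q. P p \<Longrightarrow> P q \<Longrightarrow> P (p + q)"
  shows "P p"
proof (induction p rule: update_induct)
  case const
  show ?case using single[of "{#}" 0] by simp
next
  case (update f a b)
  have "Poly_Mapping.update a b f = f + Poly_Mapping.single a b"
    using update(1)
    by (intro poly_mapping_eqI) (auto simp: lookup_update lookup_add lookup_single in_keys_iff)
  then show ?case using sum[OF update(3) single] by simp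
qed

lemma lookup_mult_empty:
  fixes p q :: "'v multiset \<Rightarrow>\<^sub>0 complex"
  shows "Poly_Mapping.lookup (p * q) {#} = Poly_Mapping.lookup p {#} * Poly_Mapping.lookup q {#}"
proof (induction p rule: free_alg_induct)
  case (single k v)
  show ?case
  proof (induction q rule: free_alg_induct)
    case (single k' v')
    show ?case by (auto simp: mult_single lookup_single when_def)
  qed (simp_all add: distrib_left lookup_add)
qed (simp_all add: distrib_right lookup_add)

lemma sym_ideal_lookup_empty: "p \<in> sym_ideal \<Longrightarrow> Poly_Mapping.lookup p {#} = 0"
  by (induction rule: sym_ideal.induct)
     (auto simp: lookup_mult_empty lookup_add lookup_minus lookup_single when_def)

instantiation sym_alg :: (complex_vector) comm_ring_1
begin

lift_definition zero_sym_alg :: "'a sym_alg" is 0 .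
lift_definition one_sym_alg :: "'a sym_alg" is 1 .

lift_definition plus_sym_alg :: "'a sym_alg \<Rightarrow> 'a sym_alg \<Rightarrow> 'a sym_alg" is "(+)"
  unfolding sym_rel_def using sym_ideal.add by (fastforce simp: algebra_simps)

lift_definition uminus_sym_alg :: "'a sym_alg \<Rightarrow> 'a sym_alg" is uminus
  unfolding sym_rel_def using sym_ideal_uminus by fastforce

lift_definition minus_sym_alg :: "'a sym_alg \<Rightarrow> 'a sym_alg \<Rightarrow> 'a sym_alg" is "(-)"
proof -
  fix p p' q q' :: "'a multiset \<Rightarrow>\<^sub>0 complex"
  assume "sym_rel p p'" "sym_rel q q'"
  then have "(p - p') + - (q - q') \<in> sym_ideal"
    unfolding sym_rel_def by (intro sym_ideal.add sym_ideal_uminus)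
  then show "sym_rel (p - q) (p' - q')"
    by (simp add: sym_rel_def algebra_simps)
qed

lift_definition times_sym_alg :: "'a sym_alg \<Rightarrow> 'a sym_alg \<Rightarrow> 'a sym_alg" is "(*)"
proof -
  fix p p' q q' :: "'a multiset \<Rightarrow>\<^sub>0 complex"
  assume "sym_rel p p'" "sym_rel q q'"
  then have "q * (p - p') + p' * (q - q') \<in> sym_ideal"
    unfolding sym_rel_def by (intro sym_ideal.add sym_ideal_mult)
  then show "sym_rel (p * q) (p' * q')"
    by (simp add: sym_rel_def algebra_simps)
qed

instance
proof
  fix a b c :: "'a sym_alg"
  note [simp] = sym_rel_def sym_ideal.zero
  show "a * b * c = a * (b * c)" by transfer (simp add: mult.assoc)
  show "a * b = b * a" by transfer (simp add: mult.commute)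
  show "1 * a = a" by transfer simp
  show "a + b + c = a + (b + c)" by transfer (simp add: add.assoc)
  show "a + b = b + a" by transfer (simp add: add.commute)
  show "0 + a = a" by transfer simp
  show "- a + a = 0" by transfer simp
  show "a - b = a + - b" by transfer simp
  show "(a + b) * c = a * c + b * c" by transfer (simp add: distrib_right)
  show "(0 :: 'a sym_alg) \<noteq> 1"
  proof transfer
    show "\<not> sym_rel (0 :: 'a multiset \<Rightarrow>\<^sub>0 complex) 1"
    proof
      assume "sym_rel (0 :: 'a multiset \<Rightarrow>\<^sub>0 complex) 1"
      from sym_ideal_lookup_empty[OF this[unfolded sym_rel_def]] show False
        by (simp add: lookup_minus lookup_one)
    qed
  qed
qed

end

lift_definition sconst :: "complex \<Rightarrow> 'v::complex_vector sym_alg" is free_const .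

lift_definition sincl :: "'v::complex_vector \<Rightarrow> 'v sym_alg" is free_var .

lemma sincl_add: "sincl (v + w) = sincl v + sincl w"
  using sym_ideal.gen_add[of 1 v w] by transfer (simp add: sym_rel_def algebra_simps)

lemma sincl_scaleC: "sincl (scaleC c v) = sconst c * sincl v"
  using sym_ideal.gen_scale[of 1 c v] by transfer (simp add: sym_rel_def)

lemma sconst_simps [simp]: "sconst 0 = 0" "sconst 1 = 1"
  by (transfer, simp add: sym_rel_def sym_ideal.zero)+

lemma sconst_add: "sconst (c + d) = sconst c + sconst d"
  by transfer (simp add: sym_rel_def sym_ideal.zero single_add)

lemma sconst_mult: "sconst (c * d) = sconst c * sconst d"
  by transfer (simp add: sym_rel_def sym_ideal.zero mult_single)

lemma sym_alg_induct [case_names const incl add mult]: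
  assumes "\<And>c. P (sconst c)" "\<And>v. P (sincl v)"
    and "\<And>x y. P x \<Longrightarrow> P y \<Longrightarrow> P (x + y)" "\<And>x y. P x \<Longrightarrow> P y \<Longrightarrow> P (x * y)"
  shows "P x"
proof (induction x rule: sym_alg.abs_induct)
  case (1 p)
  show ?case
  proof (induction p rule: free_alg_induct)
    case (single M c)
    show ?case
    proof (induction M)
      case empty
      then show ?case using assms(1)[of c] by (simp add: sconst.abs_eq)
    next
      case (add v M)
      have "abs_sym_alg (Poly_Mapping.single (add_mset v M) c) =
            sincl v * abs_sym_alg (Poly_Mapping.single M c)"
        by (simp add: sincl.abs_eq times_sym_alg.abs_eq mult_single)
      then show ?case using add assms(2,4) by simp
    qed
  next
    case (sum p q)
    then show ?case using assms(3) by (simp flip: plus_sym_alg.abs_eq)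
  qed
qed

subsection \<open>Derivations\<close>

definition is_derivation :: "('v::complex_vector sym_alg \<Rightarrow> 'v sym_alg) \<Rightarrow> bool" where
  "is_derivation d \<longleftrightarrow> (\<forall>x y. d (x + y) = d x + d y) \<and> (\<forall>c x. d (sconst c * x) = sconst c * d x) \<and>
     (\<forall>x y. d (x * y) = d x * y + x * d y)"

definition derivation_of :: "('v::complex_vector \<Rightarrow> complex) \<Rightarrow> 'v sym_alg \<Rightarrow> 'v sym_alg" where
  "derivation_of \<phi> = (THE d. is_derivation d \<and> d 1 = 0 \<and> (\<forall>v. d (sincl v) = sconst (\<phi> v)))"

lemma derivation_unique:
  assumes "is_derivation d" "d 1 = 0" "\<forall>v. d (sincl v) = sconst (\<phi> v)"
    and "is_derivation d'" "d' 1 = 0" "\<forall>v. d' (sincl v) = sconst (\<phi> v)"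
  shows "d = d'"
proof
  fix x
  show "d x = d' x"
  proof (induction x rule: sym_alg_induct)
    case (const c)
    have "d (sconst c * 1) = 0" "d' (sconst c * 1) = 0"
      using assms unfolding is_derivation_def by (metis mult_zero_right)+
    then show ?case by simp
  qed (use assms in \<open>auto simp: is_derivation_def\<close>)
qed

definition free_der_monom :: "('v \<Rightarrow> complex) \<Rightarrow> 'v multiset \<Rightarrow> ('v multiset \<Rightarrow>\<^sub>0 complex)" where
  "free_der_monom \<phi> M = (\<Sum>v\<in>#M. Poly_Mapping.single (M - {#v#}) (\<phi> v))"

definition free_der :: "('v \<Rightarrow> complex) \<Rightarrow> ('v multiset \<Rightarrow>\<^sub>0 complex) \<Rightarrow> ('v multiset \<Rightarrow>\<^sub>0 complex)" where
  "free_der \<phi> p = (\<Sum>M\<in>Poly_Mapping.keys p. free_const (Poly_Mapping.lookup p M) * free_der_monom \<phi> M)"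

lemma free_der_superset:
  assumes "finite S" "Poly_Mapping.keys p \<subseteq> S"
  shows "free_der \<phi> p = (\<Sum>M\<in>S. free_const (Poly_Mapping.lookup p M) * free_der_monom \<phi> M)"
  unfolding free_der_def using assms
  by (intro sum.mono_neutral_left) (auto simp: in_keys_iff)

lemma free_der_add: "free_der \<phi> (p + q) = free_der \<phi> p + free_der \<phi> q"
proof -
  let ?S = "Poly_Mapping.keys p \<union> Poly_Mapping.keys q"
  have "free_der \<phi> r = (\<Sum>M\<in>?S. free_const (Poly_Mapping.lookup r M) * free_der_monom \<phi> M)"
    if "r \<in> {p, q, p + q}" for r
    using that Poly_Mapping.keys_add[of p q] by (intro free_der_superset) auto
  then show ?thesis
    by (simp add: lookup_add single_add distrib_right sum.distrib)
qed

lemma free_der_single: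
  "free_der \<phi> (Poly_Mapping.single M c) = free_const c * free_der_monom \<phi> M"
  by (subst free_der_superset[of "{M}"]) (auto)

lemma free_der_monom_add:
  "free_der_monom \<phi> (M + N) =
     Poly_Mapping.single N 1 * free_der_monom \<phi> M + Poly_Mapping.single M 1 * free_der_monom \<phi> N"
proof -
  have "(\<Sum>v\<in>#M. Poly_Mapping.single (M + N - {#v#}) (\<phi> v)) =
        (\<Sum>v\<in>#M. Poly_Mapping.single N 1 * Poly_Mapping.single (M - {#v#}) (\<phi> v))"
  proof (rule arg_cong[of _ _ sum_mset], rule image_mset_cong)
    fix v assume "v \<in># M"
    then have "M + N - {#v#} = N + (M - {#v#})"
      by (metis add.commute diff_union_single_conv)
    then show "Poly_Mapping.single (M + N - {#v#}) (\<phi> v) =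
        Poly_Mapping.single N 1 * Poly_Mapping.single (M - {#v#}) (\<phi> v)"
      by (simp only: mult_single mult_1)
  qed
  moreover have "(\<Sum>v\<in>#N. Poly_Mapping.single (M + N - {#v#}) (\<phi> v)) =
        (\<Sum>v\<in>#N. Poly_Mapping.single M 1 * Poly_Mapping.single (N - {#v#}) (\<phi> v))"
  proof (rule arg_cong[of _ _ sum_mset], rule image_mset_cong)
    fix v assume "v \<in># N"
    then have "M + N - {#v#} = M + (N - {#v#})"
      by (metis diff_union_single_conv)
    then show "Poly_Mapping.single (M + N - {#v#}) (\<phi> v) =
        Poly_Mapping.single M 1 * Poly_Mapping.single (N - {#v#}) (\<phi> v)"
      by (simp only: mult_single mult_1)
  qed
  ultimately show ?thesis
    unfolding free_der_monom_def
    by (simp only: sum_mset_distrib_left image_mset_union sum_mset.union)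
qed

lemma free_der_mult: "free_der \<phi> (p * q) = free_der \<phi> p * q + p * free_der \<phi> q"
proof (induction p rule: free_alg_induct)
  case (single M c)
  show ?case
  proof (induction q rule: free_alg_induct)
    case (single N d)
    have s: "Poly_Mapping.single K e = free_const e * Poly_Mapping.single K 1"
      for K :: "'a multiset" and e :: complex
      by (simp add: mult_single)
    have "free_der \<phi> (Poly_Mapping.single M c * Poly_Mapping.single N d) =
       free_const c * free_const d *
       (Poly_Mapping.single N 1 * free_der_monom \<phi> M + Poly_Mapping.single M 1 * free_der_monom \<phi> N)"
      by (simp add: mult_single free_der_single free_der_monom_add)
    also have "\<dots> = free_der \<phi> (Poly_Mapping.single M c) * Poly_Mapping.single N d +
        Poly_Mapping.single M c * free_der \<phi> (Poly_Mapping.single N d)"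
      unfolding free_der_single by (subst (3) s, subst (5) s) (simp add: algebra_simps)
    finally show ?case .
  qed (simp_all add: distrib_left free_der_add algebra_simps)
qed (simp_all add: distrib_right free_der_add algebra_simps)

lemma free_der_ideal:
  fixes \<phi> :: "'v::complex_vector \<Rightarrow> complex"
  assumes "\<And>v w. \<phi> (v + w) = \<phi> v + \<phi> w" "\<And>c v. \<phi> (scaleC c v) = c * \<phi> v"
  shows "p \<in> sym_ideal \<Longrightarrow> free_der \<phi> p \<in> sym_ideal"
proof (induction rule: sym_ideal.induct)
  case zero
  show ?case by (simp add: free_der_def sym_ideal.zero)
next
  case (add p q)
  then show ?case by (simp add: free_der_add sym_ideal.add)
next
  have um: "free_der \<phi> (p - q) = free_der \<phi> p - free_der \<phi> q" for p q
    using free_der_add[of \<phi> "p - q" q] by simp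
  have var: "free_der \<phi> (free_var v) = free_const (\<phi> v)" for v
    by (simp add: free_der_single free_der_monom_def)
  {
    case (gen_add r v w)
    have "free_der \<phi> (free_var (v + w) - free_var v - free_var w) = 0"
      by (simp add: um var assms single_add)
    then show ?case
      by (simp only: free_der_mult mult_zero_right add_0_right sym_ideal.gen_add)
  next
    case (gen_scale r c v)
    have "free_der \<phi> (free_const c) = 0"
      by (simp add: free_der_single free_der_monom_def)
    then have "free_der \<phi> (free_var (scaleC c v) - free_const c * free_var v) = 0"
      by (simp only: um var assms free_der_mult) (simp add: mult_single)
    then show ?case
      by (simp only: free_der_mult mult_zero_right add_0_right sym_ideal.gen_scale)
  }
qed

lemma derivation_exists:
  fixes \<phi> :: "'v::complex_vector \<Rightarrow> complex"
  assumes "\<And>v w. \<phi> (v + w) = \<phi> v + \<phi> w" "\<And>c v. \<phi> (scaleC c v) = c * \<phi> v"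
  shows "\<exists>d. is_derivation d \<and> d 1 = 0 \<and> (\<forall>v. d (sincl v) = sconst (\<phi> v))"
proof -
  define d where "d = (\<lambda>x. abs_sym_alg (free_der \<phi> (rep_sym_alg x)))"
  have abs: "d (abs_sym_alg p) = abs_sym_alg (free_der \<phi> p)" for p
  proof -
    have "sym_rel (rep_sym_alg (abs_sym_alg p)) p"
      by (rule rep_abs_rsp_left[OF Quotient3_sym_alg]) (simp add: sym_rel_def sym_ideal.zero)
    then have "free_der \<phi> (rep_sym_alg (abs_sym_alg p) - p) \<in> sym_ideal"
      unfolding sym_rel_def using free_der_ideal[OF assms] by blast
    moreover have "free_der \<phi> (q - p) = free_der \<phi> q - free_der \<phi> p" for q
      using free_der_add[of \<phi> "q - p" p] by simp
    ultimately show ?thesis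
      unfolding d_def by (simp add: sym_alg.abs_eq_iff sym_rel_def)
  qed
  have "d (x + y) = d x + d y" for x y
    by (induction x; induction y) (simp add: abs plus_sym_alg.abs_eq free_der_add)
  moreover have mult: "d (x * y) = d x * y + x * d y" for x y
    by (induction x; induction y)
       (simp add: abs plus_sym_alg.abs_eq times_sym_alg.abs_eq free_der_mult)
  moreover have const: "d (sconst c) = 0" for c
    by (simp add: sconst.abs_eq abs free_der_single free_der_monom_def zero_sym_alg.abs_eq)
  moreover have "d (sconst c * x) = sconst c * d x" for c x
    by (simp add: mult const)
  moreover have "d 1 = 0"
    using const[of 1] by simp
  moreover have "d (sincl v) = sconst (\<phi> v)" for v
    by (simp add: sincl.abs_eq sconst.abs_eq abs free_der_single free_der_monom_def)
  ultimately show ?thesis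
    unfolding is_derivation_def by (intro exI[of _ d]) blast
qed

lemma derivation_of:
  fixes \<phi> :: "'v::complex_vector \<Rightarrow> complex"
  assumes "\<And>v w. \<phi> (v + w) = \<phi> v + \<phi> w" "\<And>c v. \<phi> (scaleC c v) = c * \<phi> v"
  shows "is_derivation (derivation_of \<phi>)" "derivation_of \<phi> 1 = 0"
    "derivation_of \<phi> (sincl v) = sconst (\<phi> v)"
proof -
  have "\<exists>!d. is_derivation d \<and> d 1 = 0 \<and> (\<forall>v. d (sincl v) = sconst (\<phi> v))"
    using derivation_exists[OF assms] derivation_unique[where \<phi> = \<phi>] by blast
  from theI'[OF this]
  show "is_derivation (derivation_of \<phi>)" "derivation_of \<phi> 1 = 0"
    "derivation_of \<phi> (sincl v) = sconst (\<phi> v)"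
    unfolding derivation_of_def by auto
qed


section \<open>The fields\<close>

type_synonym DW = "DK sym_alg"

text \<open>
  For \<open>z \<in> D\<close>, \<open>double_pole n z\<close> is the \<open>n\<close>-th derivative with respect to \<open>u(z)\<close> of the form
  \<open>- du / (u - u(z))\<^sup>2\<close>. For \<open>z \<notin> D\<close> this is not an element of \<open>DK\<close> and the value is junk.
\<close>

definition double_pole :: "nat \<Rightarrow> proj_line \<Rightarrow> DK" where
  "double_pole n z = abs_DK (\<lambda>w. (deriv ^^ n) (\<lambda>t. - 1 / (w - t) ^ 2) (u z))"

lemma higher_deriv_double_pole:
  assumes "w \<noteq> z"
  shows "(deriv ^^ n) (\<lambda>t. - 1 / (w - t) ^ 2) z = - fact (Suc n) / (w - z :: complex) ^ (n + 2)"
  using assms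
proof (induction n arbitrary: z)
  case 0
  then show ?case by (simp add: power2_eq_square)
next
  case (Suc n)
  have ev: "\<forall>\<^sub>F t in nhds z. t \<noteq> w"
    using Suc.prems by (intro t1_space_nhds) auto
  have "(deriv ^^ Suc n) (\<lambda>t. - 1 / (w - t) ^ 2) z =
        deriv (\<lambda>t. - fact (Suc n) / (w - t) ^ (n + 2)) z"
    unfolding funpow.simps o_def
    by (rule deriv_cong_ev) (rule eventually_mono[OF ev], rule Suc.IH, simp_all)
  also have "\<dots> = - fact (Suc (Suc n)) / (w - z) ^ (Suc n + 2)"
  proof (rule DERIV_imp_deriv)
    have nz: "w - z \<noteq> 0" using Suc.prems by simp
    have "((\<lambda>t. - fact (Suc n) / (w - t) ^ (n + 2)) has_field_derivative
       - (- fact (Suc n) * (of_nat (n + 2) * (w - z) ^ (n + 1) * (- 1))) / ((w - z) ^ (n + 2) * (w - z) ^ (n + 2))) (at z)"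
    proof -
      have "((\<lambda>t. w - t) has_field_derivative - 1) (at z)"
        by (auto intro!: derivative_eq_intros)
      from DERIV_power[OF this, of "n + 2"]
      have g: "((\<lambda>t. (w - t) ^ (n + 2)) has_field_derivative
          of_nat (n + 2) * (w - z) ^ (n + 1) * (- 1)) (at z)"
        by (simp add: mult_ac)
      have "((\<lambda>t. - fact (Suc n) / (w - t) ^ (n + 2)) has_field_derivative
          (0 * (w - z) ^ (n + 2) - - fact (Suc n) * (of_nat (n + 2) * (w - z) ^ (n + 1) * (- 1))) /
          ((w - z) ^ (n + 2) * (w - z) ^ (n + 2))) (at z)"
        by (rule DERIV_divide[OF DERIV_const g]) (use nz in simp)
      then show ?thesis
        by (simp only: mult_zero_left diff_0)
    qed
    also have "- (- fact (Suc n) * (of_nat (n + 2) * (w - z) ^ (n + 1) * (- 1))) / ((w - z) ^ (n + 2) * (w - z) ^ (n + 2))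
       = - (fact (Suc (Suc n)) :: complex) / (w - z) ^ (Suc n + 2)"
      using nz by (simp add: divide_simps fact_Suc[of "Suc n"] del: fact_Suc)
    finally show "((\<lambda>t. - fact (Suc n) / (w - t) ^ (n + 2)) has_field_derivative
      - fact (Suc (Suc n)) / (w - z) ^ (Suc n + 2)) (at z)" .
  qed
  finally show ?case .
qed

lemma in_DK_cong:
  assumes "in_DK a" "\<And>z. \<forall>\<^sub>F w in at z. a w = b w" "\<forall>\<^sub>F w in at 0. a (1 / w) = b (1 / w)"
  shows "in_DK b"
  unfolding in_DK_def
proof
  fix p
  have ev: "\<forall>\<^sub>F w in at 0. loc_coeff a p w = loc_coeff b p w"
  proof (cases p)
    case (Fin z)
    then show ?thesis
      using assms(2)[of z] by (simp add: at_to_0[of z] eventually_filtermap add.commute)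
  next
    case Infty
    then show ?thesis
      using assms(3) by simp (auto elim: eventually_mono)
  qed
  have "loc_coeff b p meromorphic_on {0} \<longleftrightarrow> loc_coeff a p meromorphic_on {0}"
    using ev by (intro meromorphic_on_cong) (auto elim: eventually_mono)
  moreover have "residue (loc_coeff b p) 0 = residue (loc_coeff a p) 0"
    using ev by (intro residue_cong) (auto elim: eventually_mono)
  moreover have "is_pole (loc_coeff b p) 0 \<longleftrightarrow> is_pole (loc_coeff a p) 0"
    using ev by (intro is_pole_cong) (auto elim: eventually_mono)
  ultimately show "loc_coeff b p meromorphic_on {0} \<and> residue (loc_coeff b p) 0 = 0 \<and>
      (is_pole (loc_coeff b p) 0 \<longrightarrow> p \<in> D)"
    using assms(1) by (auto simp: in_DK_def)
qed

lemma in_DK_higher_pole: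
  assumes "norm z < 1"
  shows "in_DK (\<lambda>w. c / (w - z) ^ (n + 2))"
  unfolding in_DK_def
proof
  fix p
  let ?l = "loc_coeff (\<lambda>w. c / (w - z) ^ (n + 2)) p"
  have ana: "?l meromorphic_on {0} \<and> residue ?l 0 = 0 \<and> (is_pole ?l 0 \<longrightarrow> p \<in> D)"
    if "f analytic_on {0}" "\<forall>\<^sub>F w in at 0. ?l w = f w" for f
  proof -
    have "?l meromorphic_on {0} \<longleftrightarrow> f meromorphic_on {0}"
      using that by (intro meromorphic_on_cong) auto
    moreover have "residue ?l 0 = residue f 0"
      using that by (intro residue_cong) auto
    moreover have "is_pole ?l 0 \<longleftrightarrow> is_pole f 0"
      using that by (intro is_pole_cong) auto
    moreover have "residue f 0 = 0"
      using that(1) by (auto simp: analytic_at intro: residue_holo)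
    ultimately show ?thesis
      using that(1) by (auto intro: analytic_on_imp_meromorphic_on dest: analytic_at_imp_no_pole)
  qed
  show "?l meromorphic_on {0} \<and> residue ?l 0 = 0 \<and> (is_pole ?l 0 \<longrightarrow> p \<in> D)"
  proof (cases p)
    case (Fin y)
    show ?thesis
    proof (cases "y = z")
      case True
      have eq: "?l = (\<lambda>w. c / w ^ Suc (Suc n))"
        using True Fin by auto
      have "residue (\<lambda>w. (\<lambda>w. c) w / w ^ Suc (Suc n)) 0 = (deriv ^^ Suc n) (\<lambda>w. c) 0 / fact (Suc n)"
        by (rule residue_holomorphic_over_power'[of UNIV]) auto
      also have "\<dots> = 0"
        by (simp only: higher_deriv_const) simp
      finally show ?thesis
        unfolding eq using True Fin assms by (auto intro!: meromorphic_intros)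
    next
      case False
      have "?l = (\<lambda>w. c / (y + w - z) ^ (n + 2))"
        using Fin by auto
      moreover have "(\<lambda>w. c / (y + w - z) ^ (n + 2)) analytic_on {0}"
        using False by (auto intro!: analytic_intros)
      ultimately show ?thesis
        by (intro ana) auto
    qed
  next
    case Infty
    show ?thesis
    proof (rule ana)
      show "(\<lambda>w. - c * w ^ n / (1 - z * w) ^ (n + 2)) analytic_on {0}"
        by (auto intro!: analytic_intros)
      have "\<forall>\<^sub>F w in at 0. w \<noteq> (0 :: complex)"
        by (auto simp: eventually_at_filter)
      then show "\<forall>\<^sub>F w in at 0. ?l w = - c * w ^ n / (1 - z * w) ^ (n + 2)"
      proof eventually_elim
        case (elim w)
        have "1 / w - z = (1 - z * w) / w"
          using elim by (simp add: field_simps)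
        then show ?case
          using elim Infty by (simp add: power_divide power_add power2_eq_square)
      qed
    qed
  qed
qed

lemma in_DK_double_pole:
  assumes "norm z < 1"
  shows "in_DK (\<lambda>w. (deriv ^^ n) (\<lambda>t. - 1 / (w - t) ^ 2) z)"
proof (rule in_DK_cong[OF in_DK_higher_pole[OF assms, of "- fact (Suc n)" n]])
  fix y :: complex
  have "\<forall>\<^sub>F w in at y. w \<noteq> z"
    by (rule eventually_neq_at_within)
  then show "\<forall>\<^sub>F w in at y. - fact (Suc n) / (w - z) ^ (n + 2) = (deriv ^^ n) (\<lambda>t. - 1 / (w - t) ^ 2) z"
    by eventually_elim (rule higher_deriv_double_pole[symmetric])
next
  have "\<forall>\<^sub>F w in at 0. w \<noteq> 1 / z" "\<forall>\<^sub>F w in at 0. w \<noteq> (0::complex)"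
    by (rule eventually_neq_at_within)+
  then show "\<forall>\<^sub>F w in at 0. - fact (Suc n) / (1 / w - z) ^ (n + 2) = (deriv ^^ n) (\<lambda>t. - 1 / (1 / w - t) ^ 2) z"
  proof eventually_elim
    case (elim w)
    then have "1 / w \<noteq> z" by auto
    from higher_deriv_double_pole[OF this] show ?case
      by (rule sym)
  qed
qed

lemma coeff_fn_double_pole:
  assumes "norm z < 1" "w \<noteq> z"
  shows "coeff_fn (double_pole n (Fin z)) w = - fact (Suc n) / (w - z) ^ (n + 2)"
proof -
  have "same_form (\<lambda>w. (deriv ^^ n) (\<lambda>t. - 1 / (w - t) ^ 2) z) (\<lambda>w. (deriv ^^ n) (\<lambda>t. - 1 / (w - t) ^ 2) z)"
    using in_DK_double_pole[OF assms(1)] by (simp add: same_form_def)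
  then have "coeff_fn (double_pole n (Fin z)) w =
      remove_sings (\<lambda>w. (deriv ^^ n) (\<lambda>t. - 1 / (w - t) ^ 2) z) w"
    unfolding double_pole_def by (simp add: coeff_fn.abs_eq)
  also have "\<dots> = remove_sings (\<lambda>w. - fact (Suc n) / (w - z) ^ (n + 2)) w"
  proof (rule remove_sings_cong)
    have "\<forall>\<^sub>F w in at w. w \<noteq> z"
      by (rule eventually_neq_at_within)
    then show "\<forall>\<^sub>F w in at w. (deriv ^^ n) (\<lambda>t. - 1 / (w - t) ^ 2) z = - fact (Suc n) / (w - z) ^ (n + 2)"
      by eventually_elim (rule higher_deriv_double_pole)
  qed simp
  also have "\<dots> = - fact (Suc n) / (w - z) ^ (n + 2)"
    using assms(2) by (intro remove_sings_at_analytic) (auto intro!: analytic_intros)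
  finally show ?thesis .
qed

text \<open>
  The fields and their \<open>n\<close>-th derivatives in the coordinate \<open>u(z)\<close>; \<open>n = 0\<close> gives the fields
  themselves. The annihilation field is meaningful for \<open>z \<notin> D\<close>, \<open>z \<noteq> Infty\<close>.
\<close>

definition e_hat_deriv :: "nat \<Rightarrow> proj_line \<Rightarrow> DW \<Rightarrow> DW" where
  "e_hat_deriv n z \<psi> = sincl (double_pole n z) * \<psi>"

definition i_hat_deriv :: "nat \<Rightarrow> proj_line \<Rightarrow> DW \<Rightarrow> DW" where
  "i_hat_deriv n z = derivation_of (\<lambda>a. - (deriv ^^ n) (coeff_fn a) (u z))"

abbreviation e_hat :: "proj_line \<Rightarrow> DW \<Rightarrow> DW" where
  "e_hat \<equiv> e_hat_deriv 0"

abbreviation i_hat :: "proj_line \<Rightarrow> DW \<Rightarrow> DW" where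
  "i_hat \<equiv> i_hat_deriv 0"

lemma i_hat_deriv_props:
  assumes "z \<notin> D" "z \<noteq> Infty"
  shows "is_derivation (i_hat_deriv n z)" "i_hat_deriv n z 1 = 0"
    "i_hat_deriv n z (sincl a) = sconst (- (deriv ^^ n) (coeff_fn a) (u z))"
proof -
  have "Fin (u z) \<notin> D" using assms by (cases z) auto
  then have "- (deriv ^^ n) (coeff_fn (v + w)) (u z) =
      - (deriv ^^ n) (coeff_fn v) (u z) + - (deriv ^^ n) (coeff_fn w) (u z)"
    "- (deriv ^^ n) (coeff_fn (scaleC c v)) (u z) = c * - (deriv ^^ n) (coeff_fn v) (u z)" for v w c
    by (simp_all add: higher_deriv_coeff_fn_add higher_deriv_coeff_fn_scale)
  from derivation_of[of "\<lambda>a. - (deriv ^^ n) (coeff_fn a) (u z)", OF this]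
  show "is_derivation (i_hat_deriv n z)" "i_hat_deriv n z 1 = 0"
    "i_hat_deriv n z (sincl a) = sconst (- (deriv ^^ n) (coeff_fn a) (u z))"
    unfolding i_hat_deriv_def by auto
qed


section \<open>The hermitian form\<close>

definition hermitian_form :: "(DW \<Rightarrow> DW \<Rightarrow> complex) \<Rightarrow> bool" where
  "hermitian_form B \<longleftrightarrow>
     (\<forall>\<xi> \<psi> \<psi>'. B \<xi> (\<psi> + \<psi>') = B \<xi> \<psi> + B \<xi> \<psi>') \<and>
     (\<forall>c \<xi> \<psi>. B \<xi> (sconst c * \<psi>) = c * B \<xi> \<psi>) \<and>
     (\<forall>\<xi> \<xi>' \<psi>. B (\<xi> + \<xi>') \<psi> = B \<xi> \<psi> + B \<xi>' \<psi>) \<and>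
     (\<forall>c \<xi> \<psi>. B (sconst c * \<xi>) \<psi> = cnj c * B \<xi> \<psi>) \<and>
     (\<forall>\<xi> \<psi>. B \<psi> \<xi> = cnj (B \<xi> \<psi>))"

text \<open>
  The matrix elements of the fields are holomorphic, and differentiating them amounts to
  differentiating the fields. The corresponding statements for the first argument follow from
  hermitian symmetry.
\<close>

definition compatible_with_derivatives :: "(DW \<Rightarrow> DW \<Rightarrow> complex) \<Rightarrow> bool" where
  "compatible_with_derivatives B \<longleftrightarrow>
     (\<forall>\<xi> \<psi>. (\<lambda>t. B \<xi> (e_hat (Fin t) \<psi>)) holomorphic_on {t. Fin t \<in> D} \<and>
        (\<forall>n t. Fin t \<in> D \<longrightarrow>
          B \<xi> (e_hat_deriv n (Fin t) \<psi>) = (deriv ^^ n) (\<lambda>s. B \<xi> (e_hat (Fin s) \<psi>)) t)) \<and>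
     (\<forall>\<xi> \<psi>. (\<lambda>t. B \<xi> (i_hat (Fin t) \<psi>)) holomorphic_on {t. Fin t \<in> D'} \<and>
        (\<forall>n t. Fin t \<in> D' \<longrightarrow>
          B \<xi> (i_hat_deriv n (Fin t) \<psi>) = (deriv ^^ n) (\<lambda>s. B \<xi> (i_hat (Fin s) \<psi>)) t))"

text \<open>
  At \<open>Fin 0\<close> and at \<open>Infty\<close> the adjointness relations involve the annihilation field at the pole
  of \<open>u\<close>, where it is not defined. At \<open>Fin 0\<close> the holomorphy required in
  \<open>compatible_with_derivatives\<close> determines \<open>B \<xi> (e_hat z \<psi>)\<close> by continuity.
\<close>

definition vacuum_form :: "(DW \<Rightarrow> DW \<Rightarrow> complex) \<Rightarrow> bool" where
  "vacuum_form B \<longleftrightarrow> hermitian_form B \<and> compatible_with_derivatives B \<and> B 1 1 = 1 \<and>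
     (\<forall>z\<in>D - {Fin 0}. \<forall>\<xi> \<psi>. u z ^ 2 * B \<xi> (e_hat z \<psi>) = B (i_hat (Cinv z) \<xi>) \<psi>) \<and>
     (\<forall>z\<in>D' - {Infty}. \<forall>\<xi> \<psi>. u z ^ 2 * B \<xi> (i_hat z \<psi>) = B (e_hat (Cinv z) \<xi>) \<psi>)"

end

theory Submission
  imports Defs "HOL-Combinatorics.Multiset_Permutations"
begin

text \<open>
  The proof is Wick's theorem for one pair of adjoint fields. For \<open>y \<in> D\<close> with \<open>t = u(y) \<noteq> 0\<close>,
  the adjointness relation moves \<open>e_hat y\<close> from the first argument of the form to the
  annihilation field at \<open>C(y)\<close>, whose coordinate is \<open>1 / cnj t\<close>, in the second argument. That
  field is a derivation which kills the vacuum and sends the generator \<open>- du / (u - u(z))\<^sup>2\<close> to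
  \<open>1 / (1 / cnj t - u(z))\<^sup>2\<close>; together with the prefactor \<open>(1 / cnj t)\<^sup>2\<close> this contributes
  \<open>1 / (1 - u(z) cnj t)\<^sup>2\<close>. Hence pairing with \<open>e_hat y\<close> removes one of the generators of the
  second argument, in all possible ways and with these weights (\<open>vacuum_form_contract\<close>). At
  \<open>t = 0\<close> the annihilation field is unavailable, but both sides are continuous in \<open>t\<close>.

  Contracting \<open>y\<^sub>1, y\<^sub>2, \<dots>\<close> one after the other expands the matrix element into a sum over the
  orders in which the generators of the second argument are used up, that is, over enumerations of
  their index set (\<open>vacuum_form_prod\<close>). If one side is exhausted before the other, what is left
  is a pairing of the vacuum with a product of creation fields, which is zero. Rewriting enumerations
  of \<open>{..<n}\<close> as permutations of \<open>{..<n}\<close> and passing to inverses gives the stated sum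
  (\<open>sum_permutations_of_set_eq_permutes\<close>).
\<close>

lemma foldr_e_hat_eq_prod:
  "foldr e_hat zs 1 = (\<Prod>i<length zs. sincl (double_pole 0 (zs ! i)))"
  by (induction zs) (simp_all add: e_hat_deriv_def prod.lessThan_Suc_shift del: prod.lessThan_Suc)

lemma derivation_prod:
  assumes d: "is_derivation d" "d 1 = 0" and "finite I"
  shows "d (\<Prod>i\<in>I. g i) = (\<Sum>i\<in>I. d (g i) * (\<Prod>j\<in>I - {i}. g j))"
  using \<open>finite I\<close>
proof (induction I rule: finite_induct)
  case empty
  then show ?case by (simp add: d)
next
  case (insert k I)
  have "(\<Prod>j\<in>insert k I - {i}. g j) = g k * (\<Prod>j\<in>I - {i}. g j)" if "i \<in> I" for i
  proof -
    have "insert k I - {i} = insert k (I - {i})"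
      using that insert.hyps by auto
    then show ?thesis
      using insert.hyps by simp
  qed
  then have "(\<Sum>i\<in>I. d (g i) * (\<Prod>j\<in>insert k I - {i}. g j)) =
      g k * (\<Sum>i\<in>I. d (g i) * (\<Prod>j\<in>I - {i}. g j))"
    by (simp add: sum_distrib_left mult_ac)
  moreover have "d (g k * (\<Prod>i\<in>I. g i)) = d (g k) * (\<Prod>i\<in>I. g i) + g k * d (\<Prod>i\<in>I. g i)"
    using d(1) by (simp add: is_derivation_def)
  ultimately show ?case
    using insert by (simp add: insert_Diff_if)
qed

lemma i_hat_prod_double_pole:
  assumes "z \<notin> D" "z \<noteq> Infty" and "finite I" and D: "\<And>i. i \<in> I \<Longrightarrow> p i \<in> D"
  shows "i_hat z (\<Prod>i\<in>I. sincl (double_pole 0 (p i))) =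
    (\<Sum>i\<in>I. sconst (1 / (u z - u (p i)) ^ 2) * (\<Prod>j\<in>I - {i}. sincl (double_pole 0 (p j))))"
proof -
  have "i_hat z (sincl (double_pole 0 (p i))) = sconst (1 / (u z - u (p i)) ^ 2)" if "i \<in> I" for i
  proof -
    have "p i \<in> D"
      using D that by blast
    then obtain t where t: "p i = Fin t" "norm t < 1"
      by (auto simp: D_def)
    have "u z \<noteq> t"
      using assms(1,2) t(2) by (cases z) auto
    with t show ?thesis
      by (simp add: i_hat_deriv_props[OF assms(1,2)] coeff_fn_double_pole power2_eq_square)
  qed
  then show ?thesis
    by (simp add: derivation_prod[OF i_hat_deriv_props(1,2)[OF assms(1,2)] \<open>finite I\<close>])
qed

context
  fixes B assumes B: "hermitian_form B"
begin

lemma hermitian_form_commute: "B \<psi> \<xi> = cnj (B \<xi> \<psi>)"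
  using B unfolding hermitian_form_def by blast

lemma hermitian_form_zero_right: "B \<xi> 0 = 0"
proof -
  have "B \<xi> (sconst 0 * 0) = 0 * B \<xi> 0"
    using B unfolding hermitian_form_def by blast
  then show ?thesis by simp
qed

lemma hermitian_form_sum_right:
  assumes "finite I"
  shows "B \<xi> (\<Sum>i\<in>I. sconst (c i) * \<psi> i) = (\<Sum>i\<in>I. c i * B \<xi> (\<psi> i))"
  using assms
proof (induction I rule: finite_induct)
  case (insert i I)
  have "B \<xi> (\<psi>\<^sub>1 + \<psi>\<^sub>2) = B \<xi> \<psi>\<^sub>1 + B \<xi> \<psi>\<^sub>2" "B \<xi> (sconst c * \<psi>\<^sub>1) = c * B \<xi> \<psi>\<^sub>1" for c \<psi>\<^sub>1 \<psi>\<^sub>2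
    using B unfolding hermitian_form_def by blast+
  with insert show ?case by simp
qed (simp add: hermitian_form_zero_right)

end

text \<open>
  The second adjointness relation of \<open>vacuum_form\<close> at the point \<open>Cinv (Fin t)\<close>, which \<open>Cinv\<close> maps
  back to \<open>Fin t\<close>.
\<close>

lemma vacuum_form_e_hat_left:
  assumes "vacuum_form B" "norm t < 1" "t \<noteq> 0"
  shows "B (e_hat (Fin t) \<xi>) \<psi> = (1 / cnj t) ^ 2 * B \<xi> (i_hat (Fin (1 / cnj t)) \<psi>)"
proof -
  have "norm (1 / cnj t) > 1"
    using assms by (simp add: norm_divide)
  then have "Fin (1 / cnj t) \<in> D' - {Infty}"
    by simp
  then have "u (Fin (1 / cnj t)) ^ 2 * B \<xi> (i_hat (Fin (1 / cnj t)) \<psi>) =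
      B (e_hat (Cinv (Fin (1 / cnj t))) \<xi>) \<psi>"
    using assms(1) unfolding vacuum_form_def by blast
  then show ?thesis
    using assms by simp
qed

text \<open>
  The contraction rule. The generators are indexed by a finite set \<open>I\<close>, so that points may repeat
  and removing one generator is removing one index.
\<close>

lemma vacuum_form_contract:
  assumes B: "vacuum_form B" and y: "y \<in> D" and I: "finite I"
    and D: "\<And>i. i \<in> I \<Longrightarrow> p i \<in> D"
  shows "B (e_hat y \<xi>) (\<Prod>i\<in>I. sincl (double_pole 0 (p i))) =
    (\<Sum>i\<in>I. 1 / (1 - u (p i) * cnj (u y)) ^ 2 * B \<xi> (\<Prod>j\<in>I - {i}. sincl (double_pole 0 (p j))))"
proof -
  have herm: "hermitian_form B"
    using B by (simp add: vacuum_form_def)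
  define \<psi> where "\<psi> = (\<Prod>i\<in>I. sincl (double_pole 0 (p i)))"
  define R where "R t = (\<Sum>i\<in>I. 1 / (1 - u (p i) * cnj t) ^ 2 *
    B \<xi> (\<Prod>j\<in>I - {i}. sincl (double_pole 0 (p j))))" for t
  have pD: "norm (u (p i)) < 1" if "i \<in> I" for i
    using D[OF that] by (auto simp: D_def)
  have nonzero: "B (e_hat (Fin t) \<xi>) \<psi> = R t" if t: "norm t < 1" "t \<noteq> 0" for t
  proof -
    let ?w = "1 / cnj t"
    have w: "Fin ?w \<notin> D" "Fin ?w \<noteq> Infty"
      using t by (auto simp: norm_divide)
    have coeff: "(1 / cnj t) ^ 2 * (1 / (?w - u (p i)) ^ 2 * b) = 1 / (1 - u (p i) * cnj t) ^ 2 * b" for i b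
    proof -
      have "cnj t * (?w - u (p i)) = 1 - u (p i) * cnj t"
        using t by (simp add: algebra_simps)
      then show ?thesis
        by (simp flip: power_mult_distrib add: power_one_over)
    qed
    have "i_hat (Fin ?w) \<psi> = (\<Sum>i\<in>I. sconst (1 / (?w - u (p i)) ^ 2) *
        (\<Prod>j\<in>I - {i}. sincl (double_pole 0 (p j))))"
      using i_hat_prod_double_pole[OF w I D] unfolding \<psi>_def by simp
    then show ?thesis
      unfolding vacuum_form_e_hat_left[OF B t]
      by (simp only: hermitian_form_sum_right[OF herm I] R_def sum_distrib_left coeff)
  qed
  have "B (e_hat (Fin t) \<xi>) \<psi> = R t" if "norm t < 1" for t
  proof (cases "t = 0")
    case True
    \<comment> \<open>Holomorphy in the point is known with the field in the second argument; continuity with the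
      field in the first argument follows by conjugation.\<close>
    have "(\<lambda>t. B \<psi> (e_hat (Fin t) \<xi>)) holomorphic_on {t. Fin t \<in> D}"
      using B unfolding vacuum_form_def compatible_with_derivatives_def by blast
    moreover have "{t. Fin t \<in> D} = ball 0 1"
      by auto
    ultimately have "continuous_on (ball 0 1) (\<lambda>t. B \<psi> (e_hat (Fin t) \<xi>))"
      by (simp add: holomorphic_on_imp_continuous_on)
    then have "isCont (\<lambda>t. B \<psi> (e_hat (Fin t) \<xi>)) 0"
      by (simp add: continuous_on_eq_continuous_at)
    then have "isCont (\<lambda>t. cnj (B \<psi> (e_hat (Fin t) \<xi>))) 0"
      by (intro continuous_intros)
    then have "((\<lambda>t. B (e_hat (Fin t) \<xi>) \<psi>) \<longlongrightarrow> B (e_hat (Fin 0) \<xi>) \<psi>) (at 0)"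
      by (simp add: isCont_def hermitian_form_commute[OF herm, symmetric])
    moreover have "\<forall>\<^sub>F t in at 0. B (e_hat (Fin t) \<xi>) \<psi> = R t"
    proof -
      have "\<forall>\<^sub>F t in at 0. t \<in> ball 0 (1::real) - {0 :: complex}"
        by (rule eventually_at_in_open) auto
      then show ?thesis
        by eventually_elim (rule nonzero, auto)
    qed
    ultimately have "(R \<longlongrightarrow> B (e_hat (Fin 0) \<xi>) \<psi>) (at 0)"
      by (simp add: tendsto_cong)
    moreover have "(R \<longlongrightarrow> R 0) (at 0)"
      unfolding R_def by (intro tendsto_eq_intros refl tendsto_intros) auto
    ultimately show ?thesis
      using True by (metis LIM_unique)
  qed (use that nonzero in blast)
  moreover obtain t where "y = Fin t" "norm t < 1"
    using y by (auto simp: D_def)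
  ultimately show ?thesis
    by (simp add: \<psi>_def R_def)
qed

text \<open>
  An element \<open>is\<close> of \<open>permutations_of_set I\<close> is a list enumerating \<open>I\<close>; the entry \<open>is ! j\<close> is the index
  of the generator that is contracted with the \<open>j\<close>-th entry of \<open>ys\<close>.
\<close>

lemma vacuum_form_prod:
  assumes B: "vacuum_form B" and "set ys \<subseteq> D" and "finite I" and "\<And>i. i \<in> I \<Longrightarrow> p i \<in> D"
  shows "B (foldr e_hat ys 1) (\<Prod>i\<in>I. sincl (double_pole 0 (p i))) =
    (if length ys \<noteq> card I then 0
     else \<Sum>is\<in>permutations_of_set I. \<Prod>j<length ys. 1 / (1 - u (p (is ! j)) * cnj (u (ys ! j))) ^ 2)"
  using assms(2-)
proof (induction ys arbitrary: I)
  case Nil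
  show ?case
  proof (cases "I = {}")
    case True
    then show ?thesis
      using B by (simp add: vacuum_form_def)
  next
    case False
    have herm: "hermitian_form B"
      using B by (simp add: vacuum_form_def)
    \<comment> \<open>By hermitian symmetry a creation field may be moved to the first argument, where it is
      contracted with the empty product.\<close>
    from False obtain k where k: "k \<in> I" by blast
    have "(\<Prod>i\<in>I. sincl (double_pole 0 (p i))) =
        e_hat (p k) (\<Prod>i\<in>I - {k}. sincl (double_pole 0 (p i)))"
      using k Nil by (simp add: e_hat_deriv_def prod.remove)
    moreover have "B (e_hat (p k) \<xi>) 1 = 0" for \<xi>
      using vacuum_form_contract[OF B, of "p k" "{}"] Nil k by simp
    ultimately show ?thesis
      using False Nil hermitian_form_commute[OF herm, of 1] by simp
  qed
next
  case (Cons y ys)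
  let ?f = "\<lambda>i y. 1 / (1 - u (p i) * cnj (u y)) ^ 2"
  let ?P = "\<lambda>ys is. \<Prod>j<length ys. ?f (is ! j) (ys ! j)"
  have IH: "B (foldr e_hat ys 1) (\<Prod>j\<in>I - {i}. sincl (double_pole 0 (p j))) =
    (if length (y # ys) \<noteq> card I then 0 else \<Sum>is\<in>permutations_of_set (I - {i}). ?P ys is)"
    if "i \<in> I" for i
  proof -
    have "card I = Suc (card (I - {i}))"
      using that Cons.prems by (metis card_Suc_Diff1)
    then show ?thesis
      using Cons.IH[of "I - {i}"] Cons.prems by simp
  qed
  have "B (foldr e_hat (y # ys) 1) (\<Prod>i\<in>I. sincl (double_pole 0 (p i))) =
     (\<Sum>i\<in>I. ?f i y * B (foldr e_hat ys 1) (\<Prod>j\<in>I - {i}. sincl (double_pole 0 (p j))))"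
    using Cons.prems vacuum_form_contract[OF B, of y I p "foldr e_hat ys 1"] by simp
  also have "\<dots> = (\<Sum>i\<in>I. ?f i y * (if length (y # ys) \<noteq> card I then 0
      else \<Sum>is\<in>permutations_of_set (I - {i}). ?P ys is))"
    by (intro sum.cong refl) (simp only: IH)
  also have "\<dots> = (if length (y # ys) \<noteq> card I then 0
      else \<Sum>is\<in>permutations_of_set I. ?P (y # ys) is)"
  proof (cases "length (y # ys) = card I")
    case True
    then have "I \<noteq> {}" by auto
    \<comment> \<open>Group the enumerations of \<open>I\<close> by their first entry, the index contracted with \<open>y\<close>.\<close>
    have "(\<Sum>is\<in>permutations_of_set I. ?P (y # ys) is) =
        (\<Sum>i\<in>I. \<Sum>is\<in>(#) i ` permutations_of_set (I - {i}). ?P (y # ys) is)"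
      unfolding permutations_of_set_nonempty[OF \<open>I \<noteq> {}\<close>]
      using Cons.prems by (intro sum.UNION_disjoint) auto
    also have "\<dots> = (\<Sum>i\<in>I. ?f i y * (\<Sum>is\<in>permutations_of_set (I - {i}). ?P ys is))"
      by (simp add: sum.reindex prod.lessThan_Suc_shift sum_distrib_left del: prod.lessThan_Suc)
    finally show ?thesis
      by (simp only: True simp_thms if_False)
  qed auto
  finally show ?case .
qed

text \<open>
  On the left, the enumeration \<open>is\<close> pairs the second index \<open>j\<close> with the first index \<open>is ! j\<close>; on the right, \<open>\<sigma>\<close>
  pairs the first index \<open>i\<close> with the second index \<open>\<sigma> i\<close>. The correspondence is therefore the inverse
  of reading a list as a function.
\<close>

lemma sum_permutations_of_set_eq_permutes:
  fixes f :: "nat \<Rightarrow> nat \<Rightarrow> 'a :: comm_semiring_1"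
  shows "(\<Sum>is\<in>permutations_of_set {..<n}. \<Prod>j<n. f (is ! j) j) =
    (\<Sum>\<sigma> | \<sigma> permutes {..<n}. \<Prod>i<n. f i (\<sigma> i))"
proof -
  have "(\<Sum>is\<in>permutations_of_set {..<n}. \<Prod>j<n. f (is ! j) j) =
    (\<Sum>\<sigma> | \<sigma> permutes {..<n}. \<Prod>j<n. f (\<sigma> j) j)"
  proof (rule sum.reindex_bij_witness[where i = "\<lambda>\<sigma>. map \<sigma> [0..<n]"
        and j = "\<lambda>is i. if i < n then is ! i else i"])
    fix "is" assume "is \<in> permutations_of_set {..<n}"
    then have "is": "distinct is" "set is = {..<n}" "length is = n"
      by (simp_all add: permutations_of_set_def length_finite_permutations_of_set)
    show "map (\<lambda>i. if i < n then is ! i else i) [0..<n] = is"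
      by (rule nth_equalityI) (simp_all add: "is"(3))
    have "bij_betw ((!) is) {..<n} {..<n}"
      using "is" by (intro bij_betw_nth) simp_all
    then have "bij_betw (\<lambda>i. if i < n then is ! i else i) {..<n} {..<n}"
      by (rule iffD1[OF bij_betw_cong, rotated]) simp
    then show "(\<lambda>i. if i < n then is ! i else i) \<in> {\<sigma>. \<sigma> permutes {..<n}}"
      unfolding mem_Collect_eq by (rule bij_imp_permutes) simp
  next
    fix \<sigma> assume "\<sigma> \<in> {\<sigma>. \<sigma> permutes {..<n}}"
    then have \<sigma>: "\<sigma> permutes {..<n}" by simp
    show "(\<lambda>i. if i < n then map \<sigma> [0..<n] ! i else i) = \<sigma>"
      using permutes_not_in[OF \<sigma>] by (auto simp: fun_eq_iff)
    show "map \<sigma> [0..<n] \<in> permutations_of_set {..<n}"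
      using permutes_image[OF \<sigma>] permutes_inj[OF \<sigma>]
      by (auto simp: permutations_of_set_def distinct_map atLeast0LessThan inj_on_def)
  qed simp
  also have "\<dots> = (\<Sum>\<sigma> | \<sigma> permutes {..<n}. \<Prod>j<n. f (inv \<sigma> j) j)"
    by (rule sum_permutations_inverse)
  also have "\<dots> = (\<Sum>\<sigma> | \<sigma> permutes {..<n}. \<Prod>i<n. f i (\<sigma> i))"
  proof (rule sum.cong[OF refl])
    fix \<sigma> assume "\<sigma> \<in> {\<sigma>. \<sigma> permutes {..<n}}"
    then have \<sigma>: "\<sigma> permutes {..<n}" by simp
    have "(\<Prod>j<n. f (inv \<sigma> j) j) = (\<Prod>i<n. f (inv \<sigma> (\<sigma> i)) (\<sigma> i))"
      using prod.permute[OF \<sigma>, of "\<lambda>j. f (inv \<sigma> j) j"] by (simp add: o_def)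
    then show "(\<Prod>j<n. f (inv \<sigma> j) j) = (\<Prod>i<n. f i (\<sigma> i))"
      by (simp add: permutes_inverses[OF \<sigma>])
  qed
  finally show ?thesis .
qed

theorem proposition7p9:
  fixes B :: "DW \<Rightarrow> DW \<Rightarrow> complex" and ys zs :: "proj_line list"
  assumes "vacuum_form B"
    and "set ys \<subseteq> D" and "distinct ys"
    and "set zs \<subseteq> D" and "distinct zs"
  shows "B (foldr e_hat ys 1) (foldr e_hat zs 1) =
    (if length ys \<noteq> length zs then 0
     else \<Sum>\<sigma> | \<sigma> permutes {..<length zs}.
            \<Prod>i<length zs. 1 / (1 - u (zs ! i) * cnj (u (ys ! \<sigma> i))) ^ 2)"
proof -
  have "zs ! i \<in> D" if "i < length zs" for i
    using that assms(4) nth_mem by blast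
  then show ?thesis
    unfolding foldr_e_hat_eq_prod[of zs]
    using vacuum_form_prod[OF assms(1,2), of "{..<length zs}" "(!) zs"]
      sum_permutations_of_set_eq_permutes[where n = "length zs"
        and f = "\<lambda>i j. 1 / (1 - u (zs ! i) * cnj (u (ys ! j))) ^ 2"]
    by simp
qed

end
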